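(* Let $A, C \in \mathbb{C}^{n\times n}$ be Hermitian matrices with $C$ indefinite. Then $(A,C)$ has a finite number of (distinct) 2D-eigenvalues $(\mu,\lambda)\in\mathbb{R}^2$ if and only if the matrix pair $(A-\sigma I, C)$ is regular for every $\sigma\in\mathbb{R}$.
   Context: A Hermitian matrix is indefinite if it has at least one positive and at least one negative eigenvalue. A pair $(\mu,\lambda)\in\mathbb{R}\times\mathbb{R}$ is a 2D-eigenvalue of $(A,C)$ if there exists $x\in\mathbb{C}^n$ such that $(A-\mu C)x=\lambda x$, $x^HCx=0$ and $x^Hx=1$. The number of 2D-eigenvalues means the number of distinct pairs $(\mu,\lambda)$. A matrix pair $(M,N)$ is regular if $\det(M-\theta N)$ is not identically zero as a function of $\theta\in\mathbb{C}$; otherwise it is singular. *)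

theory Defs
  imports Complex_Main "Jordan_Normal_Form.Schur_Decomposition"
begin

definition hermitian_mat :: "complex mat \<Rightarrow> bool" where
  "hermitian_mat M \<longleftrightarrow> mat_adjoint M = M"

(* Only meant for Hermitian matrices, whose eigenvalues are all real. *)
definition indefinite_mat :: "complex mat \<Rightarrow> bool" where
  "indefinite_mat M \<longleftrightarrow>
     (\<exists>a::real. a > 0 \<and> eigenvalue M (complex_of_real a)) \<and>
     (\<exists>b::real. b < 0 \<and> eigenvalue M (complex_of_real b))"

(* The product v \<bullet>c w conjugates its second argument, so (C *\<^sub>v x) \<bullet>c x is x^H C x
   and x \<bullet>c x is x^H x. *)
definition eigenvalues_2D :: "complex mat \<Rightarrow> complex mat \<Rightarrow> (real \<times> real) set" where
  "eigenvalues_2D A C = {(mu, lam).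
     \<exists>x \<in> carrier_vec (dim_row A).
       (A - complex_of_real mu \<cdot>\<^sub>m C) *\<^sub>v x = complex_of_real lam \<cdot>\<^sub>v x \<and>
       (C *\<^sub>v x) \<bullet>c x = 0 \<and>
       x \<bullet>c x = 1}"

definition regular_pair :: "complex mat \<Rightarrow> complex mat \<Rightarrow> bool" where
  "regular_pair M N \<longleftrightarrow> \<not> (\<forall>\<theta>::complex. det (M - \<theta> \<cdot>\<^sub>m N) = 0)"

end

theory Submission
  imports Defs "HOL-Computational_Algebra.Polynomial_Factorial" "HOL-Computational_Algebra.Field_as_Ring"
begin

text \<open>
  Put $B(\mu) = A - \mu C$ and $P(\mu, \lambda) = \det (B(\mu) - \lambda I)$.

  If the pair is singular for some $\sigma$, the pencil $A - \sigma I - \theta C$ has a nonzero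
  kernel vector $x(\theta)$ with polynomial entries. For distinct real $\mu, \nu$ one has
  $x(\mu)^H C x(\nu) = 0$, hence also for $\mu = \nu$, and $(\mu, \sigma)$ is a 2D-eigenvalue
  whenever $x(\mu) \neq 0$.

  Conversely, let $Q$ be a polynomial with the same zeros as $P$ that has no common factor with
  $\partial_\mu Q$ except for factors depending on $\lambda$ only. As $B(\mu)$ is Hermitian,
  $Q(\mu, B(\mu)) = 0$ for all real $\mu$. Differentiating
  $x^H Q(\mu, B(\mu)) x = 0$ at a 2D-eigenvalue $(\mu_0, \lambda_0)$ with eigenvector $x$ gives
  $\partial_\mu Q(\mu_0, \lambda_0) = \partial_\lambda Q(\mu_0, \lambda_0) \, x^H C x = 0$.
  Eliminating $\mu$ from $Q = \partial_\mu Q = 0$ leaves finitely many $\lambda_0$, and by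
  regularity each of them belongs to finitely many $\mu_0$.
\<close>

section \<open>Eliminating a variable from a polynomial and its derivative\<close>

text \<open>Dividing out the content forces the degree to be positive: a constant prime factor of
  the primitive part would divide its content, which is 1.\<close>

lemma prime_factor_pos_degree:
  fixes d :: "'a :: field_gcd poly poly"
  assumes "degree d > 0"
  obtains f where "prime f" "f dvd d" "degree f > 0"
proof -
  let ?p = "primitive_part d"
  have dp: "degree ?p = degree d" by simp
  have "?p \<noteq> 0" using assms by auto
  moreover have "\<not> is_unit ?p"
    using assms dp by (metis gr_implies_not0 is_unit_polyE degree_pCons_0)
  ultimately obtain f where f: "f dvd ?p" "prime f" using prime_divisor_exists by blast
  have "degree f \<noteq> 0"
  proof
    assume "degree f = 0"
    then obtain c where c: "f = [:c:]" by (metis degree_eq_zeroE)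
    then have "c dvd content ?p" using f(1) const_poly_dvd_iff_dvd_content by blast
    moreover have "content ?p = 1" using \<open>?p \<noteq> 0\<close> by (simp add: content_primitive_part)
    ultimately have "is_unit f" using c by (simp add: is_unit_const_poly_iff)
    with f(2) show False by auto
  qed
  moreover have "?p dvd d" by (metis content_times_primitive_part dvd_smult dvd_refl)
  ultimately show ?thesis using that f by (metis dvd_trans gr0I)
qed

text \<open>A nonzero element of minimal degree of the ideal generated by two polynomials divides
  both up to constants; if it is not constant, its prime factors are common factors.\<close>
lemma const_combination_if_no_common_factor:
  fixes p q :: "'a :: field_gcd poly poly"
  assumes "p \<noteq> 0"
    and no_common: "\<And>f. prime f \<Longrightarrow> degree f > 0 \<Longrightarrow> f dvd p \<Longrightarrow> f dvd q \<Longrightarrow> False"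
  obtains a b r where "a * p + b * q = [:r:]" "r \<noteq> 0"
proof -
  let ?I = "\<lambda>d. d \<noteq> 0 \<and> (\<exists>a b. a * p + b * q = d)"
  have "1 * p + 0 * q = p" by simp
  with assms(1) have "?I p" by blast
  then obtain d where d: "?I d" and min: "\<And>e. ?I e \<Longrightarrow> degree d \<le> degree e"
    using arg_min_nat_lemma[of ?I p degree] by blast
  from d obtain a b where ab: "d = a * p + b * q" by metis
  \<comment> \<open>Pseudo-division stands in for division, as the coefficients are polynomials
    themselves. The remainder stays in the ideal, so by minimality of \<open>degree d\<close> it is
    0.\<close>
  have dvd: "\<exists>c. c \<noteq> 0 \<and> d dvd smult c g" if g: "u * p + v * q = g" for g u v
  proof -
    obtain c s where cs: "c \<noteq> 0" "smult c g = d * s + pseudo_mod g d"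
      using pseudo_mod(1)[of d g] d by blast
    have "pseudo_mod g d = smult c g - d * s" using cs by simp
    also have "\<dots> = ([:c:] * u - s * a) * p + ([:c:] * v - s * b) * q"
      unfolding g[symmetric] ab by (simp add: algebra_simps smult_add_right)
    finally have "pseudo_mod g d = 0"
      using pseudo_mod(2)[of d g] d min[of "pseudo_mod g d"] by (metis not_le)
    then show ?thesis using cs by (metis add.right_neutral dvd_triv_left)
  qed
  have "degree d = 0"
  proof (rule ccontr)
    assume "degree d \<noteq> 0"
    then obtain f where f: "prime f" "f dvd d" "degree f > 0" using prime_factor_pos_degree by blast
    have "f dvd g" if g: "u * p + v * q = g" for g u v
    proof -
      obtain c where c: "c \<noteq> 0" "d dvd smult c g" using dvd[OF g] by blast
      \<comment> \<open>The factor \<open>c\<close> can be cancelled: a prime of positive degree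
        does not divide a nonzero constant.\<close>
      then have "f dvd [:c:] * g" using f(2) by (auto intro: dvd_trans)
      then have "f dvd [:c:] \<or> f dvd g" using f(1) prime_dvd_mult_iff by blast
      moreover have "\<not> f dvd [:c:]" using f(3) c(1) by (auto dest: dvd_imp_degree_le)
      ultimately show ?thesis by blast
    qed
    from this[of 1 0 p] this[of 0 1 q] no_common[OF f(1,3)] show False by auto
  qed
  then obtain r where r: "d = [:r:]" by (metis degree_eq_zeroE)
  moreover have "r \<noteq> 0" using d r by auto
  ultimately show ?thesis using that ab by metis
qed

text \<open>$Q$ is found as a divisor of minimal degree with the same prime factors as $P$.\<close>
lemma squarefree_kernel_exists:
  fixes P :: "'a :: {field_gcd, field_char_0} poly poly"
  assumes "P \<noteq> 0"
  obtains Q k a b r where "Q dvd P" "P dvd Q ^ k" "a * Q + b * pderiv Q = [:r:]" "r \<noteq> 0"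
proof -
  let ?R = "\<lambda>Q. Q dvd P \<and> (\<exists>k. P dvd Q ^ k)"
  have "?R P" by (metis dvd_refl power_one_right)
  then obtain Q where Q: "?R Q" and min: "\<And>Q'. ?R Q' \<Longrightarrow> degree Q \<le> degree Q'"
    using arg_min_nat_lemma[of ?R P degree] by blast
  from Q obtain k where k: "P dvd Q ^ k" by blast
  have Q0: "Q \<noteq> 0" using Q assms by auto
  \<comment> \<open>If \<open>f\<close> divided \<open>Q = f * g\<close> and its derivative, it
    would divide \<open>pderiv f * g\<close> and hence \<open>g\<close>, because
    \<open>pderiv f\<close> is nonzero of smaller degree in characteristic 0. Then \<open>Q\<close>
    divides \<open>g ^ 2\<close>, and \<open>g\<close> is an admissible divisor of smaller
    degree.\<close>
  have False if f: "prime f" "degree f > 0" "f dvd Q" "f dvd pderiv Q" for f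
  proof -
    obtain g where g: "Q = f * g" using f(3) by blast
    have "f dvd pderiv f * g" using f(4) unfolding g pderiv_mult
      by (metis dvd_add_right_iff dvd_triv_left mult.commute)
    moreover have "\<not> f dvd pderiv f"
    proof
      assume *: "f dvd pderiv f"
      have "pderiv f \<noteq> 0" using f(2) pderiv_eq_0_iff by (metis gr_implies_not0)
      with * have "degree f \<le> degree (pderiv f)" by (rule dvd_imp_degree_le)
      then show False using degree_pderiv[of f] f(2) by simp
    qed
    ultimately have "f dvd g" using f(1) prime_dvd_mult_iff by blast
    then have "Q dvd g ^ 2" unfolding g power2_eq_square by simp
    then have "Q ^ k dvd g ^ (2 * k)" by (simp add: dvd_power_same power_mult)
    with k have "P dvd g ^ (2 * k)" using dvd_trans by blast
    moreover have "g dvd P" using Q g dvd_mult_right by blast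
    ultimately have "degree Q \<le> degree g" using min by blast
    then show False using g Q0 f(2) by (simp add: degree_mult_eq)
  qed
  then obtain a b r where "a * Q + b * pderiv Q = [:r:]" "r \<noteq> 0"
    using const_combination_if_no_common_factor[OF Q0, of "pderiv Q"] by blast
  then show ?thesis using that Q k by blast
qed

section \<open>Hermitian matrices\<close>

lemma hermitian_mat_conj:
  assumes "hermitian_mat M" "M \<in> carrier_mat n n" "i < n" "j < n"
  shows "cnj (M $$ (i, j)) = M $$ (j, i)"
proof -
  have "mat_adjoint M $$ (j, i) = cnj (M $$ (i, j))"
    unfolding mat_adjoint_def using assms by (simp add: mat_of_rows_index cols_nth)
  then show ?thesis using assms(1) unfolding hermitian_mat_def by simp
qed

lemma hermitian_mat_I:
  assumes "M \<in> carrier_mat n n" "\<And>i j. i < n \<Longrightarrow> j < n \<Longrightarrow> cnj (M $$ (i, j)) = M $$ (j, i)"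
  shows "hermitian_mat M"
  unfolding hermitian_mat_def mat_adjoint_def
  by (rule eq_matI) (use assms in \<open>auto simp: mat_of_rows_index cols_nth\<close>)

lemma hermitian_mat_diff_smult:
  assumes "hermitian_mat M" "M \<in> carrier_mat n n" "hermitian_mat N" "N \<in> carrier_mat n n"
  shows "hermitian_mat (M - complex_of_real c \<cdot>\<^sub>m N)"
  by (rule hermitian_mat_I[of _ n])
     (use assms hermitian_mat_conj[of M n] hermitian_mat_conj[of N n] in auto)

lemma hermitian_mat_one: "hermitian_mat (1\<^sub>m n)"
  by (rule hermitian_mat_I[of _ n]) auto

lemma hermitian_cscalar_prod:
  assumes "hermitian_mat M" "M \<in> carrier_mat n n" "v \<in> carrier_vec n" "w \<in> carrier_vec n"
  shows "(M *\<^sub>v v) \<bullet>c w = v \<bullet>c (M *\<^sub>v w)"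
proof -
  have "(M *\<^sub>v v) \<bullet>c w = (\<Sum>i<n. \<Sum>j<n. M $$ (i, j) * v $ j * cnj (w $ i))"
    using assms by (simp add: scalar_prod_def sum_distrib_right lessThan_atLeast0)
  also have "\<dots> = (\<Sum>j<n. \<Sum>i<n. M $$ (i, j) * v $ j * cnj (w $ i))"
    by (rule sum.swap)
  also have "\<dots> = (\<Sum>j<n. v $ j * cnj (\<Sum>i<n. M $$ (j, i) * w $ i))"
    using hermitian_mat_conj[OF assms(1,2)]
    by (auto simp: sum_distrib_left mult_ac intro!: sum.cong)
  also have "\<dots> = v \<bullet>c (M *\<^sub>v w)"
    using assms by (simp add: scalar_prod_def lessThan_atLeast0)
  finally show ?thesis .
qed

lemma hermitian_eigenvalue_real:
  assumes M: "hermitian_mat M" "M \<in> carrier_mat n n" and v: "v \<in> carrier_vec n" "v \<noteq> 0\<^sub>v n"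
    and eq: "M *\<^sub>v v = a \<cdot>\<^sub>v v"
  shows "a \<in> \<real>"
proof -
  have "a * (v \<bullet>c v) = cnj a * (v \<bullet>c v)"
    using hermitian_cscalar_prod[OF M v(1) v(1)] v(1) unfolding eq
    by (simp add: conjugate_smult_vec)
  moreover have "v \<bullet>c v \<noteq> 0" using v by simp
  ultimately show ?thesis by (simp add: Reals_cnj_iff)
qed

text \<open>Moving one factor \<open>M\<close> across the inner product turns the squared norm of
  \<open>M *\<^sub>v v\<close> into the product of \<open>M *\<^sub>v (M *\<^sub>v v)\<close> with
  \<open>v\<close>. This excludes nontrivial Jordan chains.\<close>

lemma hermitian_kernel_square:
  assumes M: "hermitian_mat M" "M \<in> carrier_mat n n" and v: "v \<in> carrier_vec n"
    and "M *\<^sub>v (M *\<^sub>v v) = 0\<^sub>v n"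
  shows "M *\<^sub>v v = 0\<^sub>v n"
proof -
  have "(M *\<^sub>v v) \<bullet>c (M *\<^sub>v v) = (M *\<^sub>v (M *\<^sub>v v)) \<bullet>c v"
    using hermitian_cscalar_prod[OF M, of "M *\<^sub>v v" v] M v by simp
  also have "\<dots> = 0" using assms by simp
  finally show ?thesis using conjugate_square_eq_0_vec[of "M *\<^sub>v v" n] M v by simp
qed

section \<open>Polynomials in a matrix applied to a vector\<close>

text \<open>Horner's scheme for p(M) v. Acting on a vector avoids matrix powers and matrix
  polynomials.\<close>

definition poly_mat_vec :: "'a :: comm_ring_1 poly \<Rightarrow> 'a mat \<Rightarrow> 'a vec \<Rightarrow> 'a vec" where
  "poly_mat_vec p M v = fold_coeffs (\<lambda>a w. a \<cdot>\<^sub>v v + M *\<^sub>v w) p (0\<^sub>v (dim_vec v))"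

lemma smult_mat_mult_vec:
  fixes M :: "'a :: comm_ring_1 mat"
  assumes "M \<in> carrier_mat m n" "v \<in> carrier_vec n"
  shows "(c \<cdot>\<^sub>m M) *\<^sub>v v = c \<cdot>\<^sub>v (M *\<^sub>v v)"
  using assms by (intro eq_vecI) auto

context
  fixes M :: "'a :: comm_ring_1 mat" and n :: nat
  assumes M: "M \<in> carrier_mat n n"
begin

lemma mat_vec_zero: "M *\<^sub>v 0\<^sub>v n = 0\<^sub>v n"
  using M by (intro eq_vecI) auto

lemma mat_vec_scale: "v \<in> carrier_vec n \<Longrightarrow> M *\<^sub>v (c \<cdot>\<^sub>v v) = c \<cdot>\<^sub>v (M *\<^sub>v v)"
  using M by (intro eq_vecI) auto

lemma poly_mat_vec_0: "v \<in> carrier_vec n \<Longrightarrow> poly_mat_vec 0 M v = 0\<^sub>v n"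
  by (simp add: poly_mat_vec_def)

lemma poly_mat_vec_pCons:
  assumes v: "v \<in> carrier_vec n"
  shows "poly_mat_vec (pCons a p) M v = a \<cdot>\<^sub>v v + M *\<^sub>v poly_mat_vec p M v"
proof (cases "pCons a p = 0")
  \<comment> \<open>\<open>fold_coeffs\<close> sees no coefficient at all in
    \<open>pCons 0 0\<close>, so its recursion does not cover this case.\<close>
  case True
  have "a \<cdot>\<^sub>v v + M *\<^sub>v 0\<^sub>v n = 0\<^sub>v n"
    using True v M by (intro eq_vecI) (auto simp: mat_vec_zero)
  with True v show ?thesis by (simp add: poly_mat_vec_0)
next
  case False
  then show ?thesis unfolding poly_mat_vec_def
    by (cases "a = 0") auto
qed

lemma poly_mat_vec_carrier:
  assumes v: "v \<in> carrier_vec n"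
  shows "poly_mat_vec p M v \<in> carrier_vec n"
proof (induct p)
  case 0
  then show ?case using v by (simp add: poly_mat_vec_0)
next
  case (pCons a p)
  then show ?case using v M by (simp add: poly_mat_vec_pCons)
qed

lemma poly_mat_vec_zero_vec: "poly_mat_vec p M (0\<^sub>v n) = 0\<^sub>v n"
  by (induct p) (simp_all add: poly_mat_vec_0 poly_mat_vec_pCons mat_vec_zero, auto)

lemma poly_mat_vec_add:
  assumes v: "v \<in> carrier_vec n"
  shows "poly_mat_vec (p + q) M v = poly_mat_vec p M v + poly_mat_vec q M v"
proof (induct p q rule: poly_induct2)
  case 0
  then show ?case using v by (simp add: poly_mat_vec_0)
next
  case (pCons a p b q)
  have c: "poly_mat_vec p M v \<in> carrier_vec n" "poly_mat_vec q M v \<in> carrier_vec n"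
    using poly_mat_vec_carrier[OF v] by auto
  have "poly_mat_vec (pCons a p + pCons b q) M v =
      (a + b) \<cdot>\<^sub>v v + M *\<^sub>v (poly_mat_vec p M v + poly_mat_vec q M v)"
    using pCons v by (simp add: poly_mat_vec_pCons)
  also have "\<dots> = (a \<cdot>\<^sub>v v + M *\<^sub>v poly_mat_vec p M v) + (b \<cdot>\<^sub>v v + M *\<^sub>v poly_mat_vec q M v)"
    unfolding mult_add_distrib_mat_vec[OF M c] using v M c
    by (intro eq_vecI) (auto simp: algebra_simps)
  finally show ?case using v by (simp add: poly_mat_vec_pCons)
qed

lemma poly_mat_vec_smult:
  assumes v: "v \<in> carrier_vec n"
  shows "poly_mat_vec (smult c p) M v = c \<cdot>\<^sub>v poly_mat_vec p M v"
proof (induct p)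
  case 0
  then show ?case using v by (auto simp: poly_mat_vec_0)
next
  case (pCons a p)
  have c: "poly_mat_vec p M v \<in> carrier_vec n" using poly_mat_vec_carrier[OF v] .
  show ?case using v c M pCons
    by (simp add: poly_mat_vec_pCons mat_vec_scale smult_smult_assoc smult_add_distrib_vec)
qed

lemma poly_mat_vec_commute:
  assumes N: "N \<in> carrier_mat n n" "M * N = N * M" and v: "v \<in> carrier_vec n"
  shows "poly_mat_vec p M (N *\<^sub>v v) = N *\<^sub>v poly_mat_vec p M v"
proof (induct p)
  case 0
  have "N *\<^sub>v 0\<^sub>v n = 0\<^sub>v n" using N by (intro eq_vecI) auto
  then show ?case using v N by (simp add: poly_mat_vec_0)
next
  case (pCons a p)
  have c: "poly_mat_vec p M v \<in> carrier_vec n" using poly_mat_vec_carrier[OF v] .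
  have "M *\<^sub>v (N *\<^sub>v poly_mat_vec p M v) = N *\<^sub>v (M *\<^sub>v poly_mat_vec p M v)"
    using assoc_mult_mat_vec[OF M N(1) c] assoc_mult_mat_vec[OF N(1) M c] N(2) by metis
  moreover have "N *\<^sub>v (a \<cdot>\<^sub>v v) = a \<cdot>\<^sub>v (N *\<^sub>v v)"
    using N v by (intro eq_vecI) auto
  ultimately show ?case using v c M N pCons
    by (simp add: poly_mat_vec_pCons mult_add_distrib_mat_vec[of _ n n])
qed

lemma poly_mat_vec_linear_factor:
  assumes v: "v \<in> carrier_vec n"
  shows "poly_mat_vec ([:- a, 1:] * p) M v = (M - a \<cdot>\<^sub>m 1\<^sub>m n) *\<^sub>v poly_mat_vec p M v"
proof -
  have c: "poly_mat_vec p M v \<in> carrier_vec n" using poly_mat_vec_carrier[OF v] .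
  have "[:- a, 1:] * p = smult (- a) p + pCons 0 p" by simp
  then have "poly_mat_vec ([:- a, 1:] * p) M v =
      - a \<cdot>\<^sub>v poly_mat_vec p M v + (0 \<cdot>\<^sub>v v + M *\<^sub>v poly_mat_vec p M v)"
    using v by (simp only: poly_mat_vec_add poly_mat_vec_smult poly_mat_vec_pCons)
  also have "\<dots> = (M - a \<cdot>\<^sub>m 1\<^sub>m n) *\<^sub>v poly_mat_vec p M v"
    using v M c by (intro eq_vecI) (auto simp: minus_mult_distrib_mat_vec[of _ n n] smult_mat_mult_vec[of _ n n])
  finally show ?thesis .
qed

end


text \<open>Expands Horner's scheme in the Krylov vectors M^k v, so that annihilating
  \<open>v\<close> becomes a linear system for the coefficients.\<close>

lemma poly_mat_vec_Poly:
  fixes M :: "'a :: comm_ring_1 mat"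
  assumes M: "M \<in> carrier_mat n n" and v: "v \<in> carrier_vec n" and "i < n"
  shows "poly_mat_vec (Poly cs) M v $ i = (\<Sum>k<length cs. cs ! k * (((*\<^sub>v) M ^^ k) v $ i))"
  using \<open>i < n\<close>
proof (induct cs arbitrary: i)
  case Nil
  then show ?case using poly_mat_vec_0[OF M v] by simp
next
  case (Cons a cs)
  let ?w = "\<lambda>k. ((*\<^sub>v) M ^^ k) v"
  have w: "?w k \<in> carrier_vec n" for k using M v by (induct k) auto
  have c: "poly_mat_vec (Poly cs) M v \<in> carrier_vec n" using poly_mat_vec_carrier[OF M v] .
  have "(M *\<^sub>v poly_mat_vec (Poly cs) M v) $ i = (\<Sum>j<n. M $$ (i, j) * (\<Sum>k<length cs. cs ! k * ?w k $ j))"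
    using Cons M c by (simp add: scalar_prod_def lessThan_atLeast0)
  also have "\<dots> = (\<Sum>k<length cs. \<Sum>j<n. M $$ (i, j) * (cs ! k * ?w k $ j))"
    unfolding sum_distrib_left by (rule sum.swap)
  also have "\<dots> = (\<Sum>k<length cs. cs ! k * (M *\<^sub>v ?w k) $ i)"
    using M w[THEN carrier_vecD] Cons.prems
    by (auto simp: scalar_prod_def lessThan_atLeast0 sum_distrib_left mult_ac intro!: sum.cong)
  finally have "poly_mat_vec (Poly (a # cs)) M v $ i = a * v $ i + (\<Sum>k<length cs. cs ! k * ?w (Suc k) $ i)"
    using Cons.prems v M c by (simp add: poly_mat_vec_pCons)
  then show ?case by (simp add: sum.lessThan_Suc_shift del: sum.lessThan_Suc funpow.simps(2))
qed

text \<open>The n + 1 vectors v, M v, ..., M^n v of length n are linearly dependent; a dependency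
  supplies the coefficients.\<close>

lemma annihilating_poly_exists:
  fixes M :: "'a :: idom mat"
  assumes M: "M \<in> carrier_mat n n" and v: "v \<in> carrier_vec n"
  obtains p where "p \<noteq> 0" "poly_mat_vec p M v = 0\<^sub>v n"
proof -
  \<comment> \<open>The columns are the Krylov vectors. A zero row is appended to make the matrix
    square, so that the determinant criterion for kernel vectors applies.\<close>
  define K where "K = mat (Suc n) (Suc n) (\<lambda>(i, k). if i < n then ((*\<^sub>v) M ^^ k) v $ i else 0)"
  have K: "K \<in> carrier_mat (Suc n) (Suc n)" unfolding K_def by simp
  \<comment> \<open>The zero row makes the last unit vector a kernel vector of the transpose, hence
    \<open>det K = 0\<close>.\<close>
  have "transpose_mat K *\<^sub>v unit_vec (Suc n) n = 0\<^sub>v (Suc n)"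
    unfolding K_def by (intro eq_vecI) auto
  moreover have "unit_vec (Suc n) n \<noteq> (0\<^sub>v (Suc n) :: 'a vec)"
    by (metis index_unit_vec(2) index_zero_vec(1) lessI zero_neq_one)
  ultimately have "det (transpose_mat K) = 0"
    using det_0_iff_vec_prod_zero[of "transpose_mat K" "Suc n"] K
    by (metis transpose_carrier_mat unit_vec_carrier)
  then have "det K = 0" using det_transpose[OF K] by simp
  then obtain c where c: "c \<in> carrier_vec (Suc n)" "c \<noteq> 0\<^sub>v (Suc n)" "K *\<^sub>v c = 0\<^sub>v (Suc n)"
    using det_0_iff_vec_prod_zero[OF K] by blast
  let ?p = "Poly (list_of_vec c)"
  have "?p \<noteq> 0"
  proof
    assume "?p = 0"
    then have "coeff ?p i = 0" for i by simp
    then have "c $ i = 0" if "i < Suc n" for i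
      using that c(1) by (metis coeff_Poly_eq carrier_vecD length_list_of_vec nth_default_nth nth_list_of_vec)
    then show False using c(1,2) by (auto intro!: eq_vecI)
  qed
  moreover have "poly_mat_vec ?p M v = 0\<^sub>v n"
  proof (rule eq_vecI)
    fix i assume i: "i < dim_vec (0\<^sub>v n)"
    have "(\<Sum>k<Suc n. c $ k * (((*\<^sub>v) M ^^ k) v $ i)) = (K *\<^sub>v c) $ i"
      using c(1) i unfolding K_def
      by (auto simp: scalar_prod_def lessThan_atLeast0 mult_ac simp del: sum.op_ivl_Suc intro!: sum.cong)
    then show "poly_mat_vec ?p M v $ i = 0\<^sub>v n $ i"
      using i c by (simp add: poly_mat_vec_Poly[OF M v] list_of_vec_index del: sum.lessThan_Suc)
  qed (use poly_mat_vec_carrier[OF M v] in auto)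
  ultimately show ?thesis using that by blast
qed

text \<open>Induction on the degree of a polynomial annihilating $v$: its linear factors are
  removed one at a time, which is possible because eigenvectors and generalized eigenvectors
  of a Hermitian matrix coincide.\<close>
lemma hermitian_poly_mat_vec_eq_0:
  assumes M: "hermitian_mat M" "M \<in> carrier_mat n n" and v: "v \<in> carrier_vec n"
    and q: "\<And>a. eigenvalue M a \<Longrightarrow> poly q a = 0"
  shows "poly_mat_vec q M v = 0\<^sub>v n"
proof -
  \<comment> \<open>The vector must vary in the induction: removing a factor from \<open>p\<close>
    replaces \<open>v\<close> by its image under \<open>?N\<close>.\<close>
  have "poly_mat_vec q M v = 0\<^sub>v n"
    if "p \<noteq> 0" "poly_mat_vec p M v = 0\<^sub>v n" "v \<in> carrier_vec n" for p v
    using that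
  proof (induct "degree p" arbitrary: p v)
    case 0
    then obtain a where a: "p = [:a:]" "a \<noteq> 0" by (metis degree_eq_zeroE pCons_0_0)
    have "a \<cdot>\<^sub>v v = 0\<^sub>v n"
      using 0 M(2) by (simp add: a poly_mat_vec_pCons[of M n] poly_mat_vec_0[of M n] mat_vec_zero[of M n])
    then have "a * v $ i = 0" if "i < n" for i using that 0
      by (metis carrier_vecD index_smult_vec(1) index_zero_vec(1))
    then have "v = 0\<^sub>v n" using a 0 by (intro eq_vecI) auto
    then show ?case using poly_mat_vec_zero_vec[OF M(2)] by simp
  next
    case (Suc d)
    then obtain a where "poly p a = 0"
      using fundamental_theorem_of_algebra constant_degree by (metis nat.distinct(1))
    then obtain p' where p: "p = [:- a, 1:] * p'" using poly_eq_0_iff_dvd by blast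
    let ?N = "M - a \<cdot>\<^sub>m 1\<^sub>m n"
    have N: "?N \<in> carrier_mat n n" by (simp add: minus_carrier_mat)
    have Nv: "?N *\<^sub>v w = M *\<^sub>v w - a \<cdot>\<^sub>v w" if "w \<in> carrier_vec n" for w
      using M that by (simp add: minus_mult_distrib_mat_vec[of _ n n] smult_mat_mult_vec[of _ n n])
    have comm: "poly_mat_vec r M (?N *\<^sub>v v) = ?N *\<^sub>v poly_mat_vec r M v" for r
    proof (rule poly_mat_vec_commute[OF M(2) N])
      have "M * (a \<cdot>\<^sub>m 1\<^sub>m n) = a \<cdot>\<^sub>m M" "(a \<cdot>\<^sub>m 1\<^sub>m n) * M = a \<cdot>\<^sub>m M"
        using mult_smult_distrib[OF M(2) one_carrier_mat, of a]
          mult_smult_assoc_mat[OF one_carrier_mat M(2), of a] M(2) by simp_all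
      then show "M * ?N = ?N * M" using M
        by (simp add: mult_minus_distrib_mat[of _ n n] minus_mult_distrib_mat[of _ n n])
    qed fact
    have "p' \<noteq> 0" using Suc.prems(1) p by auto
    moreover from this have "d = degree p'"
      using Suc.hyps(2) unfolding p by (subst (asm) degree_mult_eq) auto
    moreover have "poly_mat_vec p' M (?N *\<^sub>v v) = 0\<^sub>v n"
      using Suc.prems(2) unfolding comm p poly_mat_vec_linear_factor[OF M(2) Suc.prems(3)] .
    ultimately have "poly_mat_vec q M (?N *\<^sub>v v) = 0\<^sub>v n"
      using Suc.hyps(1)[of p' "?N *\<^sub>v v"] mult_mat_vec_carrier[OF N Suc.prems(3)] by blast
    then have *: "?N *\<^sub>v poly_mat_vec q M v = 0\<^sub>v n" by (simp add: comm)
    show ?case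
    proof (cases "eigenvalue M a")
      \<comment> \<open>Here \<open>q\<close> contains the factor removed from \<open>p\<close>, so
        q(M) v is an image under \<open>?N\<close>. It also lies in the kernel of \<open>?N\<close>,
        which is Hermitian as \<open>a\<close> is real, so it vanishes.\<close>
      case True
      then have "a \<in> \<real>" using hermitian_eigenvalue_real[OF M]
        unfolding eigenvalue_def eigenvector_def using M by auto
      then have N': "hermitian_mat ?N"
        using hermitian_mat_diff_smult[OF M hermitian_mat_one[of n]] by (auto elim!: Reals_cases)
      obtain q' where "q = [:- a, 1:] * q'" using q[OF True] poly_eq_0_iff_dvd by blast
      then have q': "poly_mat_vec q M v = ?N *\<^sub>v poly_mat_vec q' M v"
        using poly_mat_vec_linear_factor[OF M(2)] Suc.prems by simp
      show ?thesis unfolding q'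
        using hermitian_kernel_square[OF N' N] poly_mat_vec_carrier[OF M(2) Suc.prems(3)] *
        unfolding q' by blast
    next
      \<comment> \<open>A nonzero kernel vector of \<open>?N\<close> would be an eigenvector of
        \<open>M\<close> for \<open>a\<close>.\<close>
      case False
      have c: "poly_mat_vec q M v \<in> carrier_vec n" using poly_mat_vec_carrier[OF M(2) Suc.prems(3)] .
      have "M *\<^sub>v poly_mat_vec q M v = a \<cdot>\<^sub>v poly_mat_vec q M v"
      proof (rule eq_vecI)
        fix i assume "i < dim_vec (a \<cdot>\<^sub>v poly_mat_vec q M v)"
        then show "(M *\<^sub>v poly_mat_vec q M v) $ i = (a \<cdot>\<^sub>v poly_mat_vec q M v) $ i"
          using arg_cong[OF *, of "\<lambda>w. w $ i"] c M unfolding Nv[OF c] by simp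
      qed (use c M in auto)
      then show ?thesis using False c M unfolding eigenvalue_def eigenvector_def by auto
    qed
  qed
  then show ?thesis using annihilating_poly_exists[OF M(2) v] v by blast
qed

section \<open>Hermitian pencils\<close>

lemma mat_diff_smult_mult_vec:
  fixes M N :: "'a :: comm_ring_1 mat"
  assumes "M \<in> carrier_mat m n" "N \<in> carrier_mat m n" "v \<in> carrier_vec n"
  shows "(M - c \<cdot>\<^sub>m N) *\<^sub>v v = M *\<^sub>v v - c \<cdot>\<^sub>v (N *\<^sub>v v)"
  using assms by (simp add: minus_mult_distrib_mat_vec[of _ m n] smult_mat_mult_vec[of _ m n])

lemma vec_eq_iff_diff_eq_0:
  fixes v w :: "'a :: ring_1 vec"
  assumes "v \<in> carrier_vec n" "w \<in> carrier_vec n"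
  shows "v = w \<longleftrightarrow> v - w = 0\<^sub>v n"
proof
  assume *: "v - w = 0\<^sub>v n"
  show "v = w"
  proof (rule eq_vecI)
    fix i assume "i < dim_vec w"
    then show "v $ i = w $ i" using arg_cong[OF *, of "\<lambda>u. u $ i"] assms by simp
  qed (use assms in auto)
qed (use assms in auto)

text \<open>One determinant read in two ways: as that of the pencil shifted by \<open>l\<close>,
  which regularity is about, and as the characteristic determinant of
  \<open>A - m \<cdot>\<^sub>m C\<close>.\<close>

lemma det_pencil_eq_0_iff:
  fixes A C :: "'a :: field mat"
  assumes A: "A \<in> carrier_mat n n" and C: "C \<in> carrier_mat n n"
  shows "det (A - l \<cdot>\<^sub>m 1\<^sub>m n - m \<cdot>\<^sub>m C) = 0 \<longleftrightarrow> eigenvalue (A - m \<cdot>\<^sub>m C) l"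
proof -
  have E: "A - l \<cdot>\<^sub>m 1\<^sub>m n - m \<cdot>\<^sub>m C \<in> carrier_mat n n" using C by (simp add: minus_carrier_mat)
  have "A - l \<cdot>\<^sub>m 1\<^sub>m n - m \<cdot>\<^sub>m C = (A - m \<cdot>\<^sub>m C) - l \<cdot>\<^sub>m 1\<^sub>m n" using A C by (intro eq_matI) auto
  moreover have "((A - m \<cdot>\<^sub>m C) - l \<cdot>\<^sub>m 1\<^sub>m n) *\<^sub>v v = 0\<^sub>v n \<longleftrightarrow> (A - m \<cdot>\<^sub>m C) *\<^sub>v v = l \<cdot>\<^sub>v v"
    if v: "v \<in> carrier_vec n" for v
  proof -
    have M: "A - m \<cdot>\<^sub>m C \<in> carrier_mat n n" using C by (simp add: minus_carrier_mat)
    show ?thesis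
      unfolding mat_diff_smult_mult_vec[OF M one_carrier_mat v] one_mult_mat_vec[OF v]
      using vec_eq_iff_diff_eq_0[OF mult_mat_vec_carrier[OF M v] smult_carrier_vec[THEN iffD2, OF v]]
      by blast
  qed
  moreover have "dim_row (A - m \<cdot>\<^sub>m C) = n" using C by simp
  ultimately show ?thesis
    unfolding det_0_iff_vec_prod_zero[OF E] eigenvalue_def eigenvector_def by metis
qed

text \<open>The outer variable of the characteristic polynomial of the pencil is the parameter
  $\mu$, the inner one is the spectral variable $\lambda$.\<close>
definition pencil_poly :: "'a :: comm_ring_1 mat \<Rightarrow> 'a mat \<Rightarrow> 'a poly poly" where
  "pencil_poly A C = det (mat (dim_row A) (dim_row A)
     (\<lambda>(i, j). [: [:A $$ (i, j), if i = j then - 1 else 0:], [:- C $$ (i, j):] :]))"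

lemma poly_pencil_poly:
  fixes A C :: "'a :: comm_ring_1 mat"
  assumes A: "A \<in> carrier_mat n n" and C: "C \<in> carrier_mat n n"
  shows "poly (poly (pencil_poly A C) [:m:]) l = det (A - l \<cdot>\<^sub>m 1\<^sub>m n - m \<cdot>\<^sub>m C)"
proof -
  interpret comm_ring_hom "\<lambda>p :: 'a poly poly. poly (poly p [:m:]) l"
    by standard simp_all
  show ?thesis unfolding pencil_poly_def hom_det[symmetric]
    by (rule arg_cong[of _ _ det], rule eq_matI) (use A C in auto)
qed

text \<open>Freezing the inner variable leaves an ordinary polynomial in \<mu>, whose roots can be
  counted.\<close>

lemma poly_map_poly_poly:
  "poly (map_poly (\<lambda>c. poly c l) P) m = poly (poly P [:m:]) (l :: 'a :: comm_ring_1)"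
  by (induct P) (simp_all add: map_poly_pCons)

section \<open>Differentiation along the pencil at an isotropic eigenvector\<close>

lemma has_vector_derivative_complex_of_real:
  "((\<lambda>t. complex_of_real t) has_vector_derivative 1) (at t)"
  using has_vector_derivative_of_real[OF DERIV_ident, of "at t", where ?'a = complex] by simp

lemma vec_diff_swap:
  fixes u v w :: "'a :: ab_group_add vec"
  assumes "u - v = w" "u \<in> carrier_vec n" "v \<in> carrier_vec n"
  shows "u - w = v"
  using assms by (intro eq_vecI) auto

context
  fixes A C :: "complex mat" and n :: nat and x :: "complex vec" and mu lam :: real
  assumes A: "A \<in> carrier_mat n n" "hermitian_mat A"
    and C: "C \<in> carrier_mat n n" "hermitian_mat C"
    and x: "x \<in> carrier_vec n"
    and eig: "(A - complex_of_real mu \<cdot>\<^sub>m C) *\<^sub>v x = complex_of_real lam \<cdot>\<^sub>v x"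
    and isotropic: "(C *\<^sub>v x) \<bullet>c x = 0"
begin

abbreviation (input) pencil :: "real \<Rightarrow> complex mat" where
  "pencil t \<equiv> A - complex_of_real t \<cdot>\<^sub>m C"

lemma pencil_carrier: "pencil t \<in> carrier_mat n n"
  using C by (simp add: minus_carrier_mat)

lemma pencil_hermitian: "hermitian_mat (pencil t)"
  using hermitian_mat_diff_smult A C by blast

lemma poly_mat_vec_pencil_eigenvector:
  "poly_mat_vec p (pencil mu) x = poly p (complex_of_real lam) \<cdot>\<^sub>v x"
proof (induct p)
  case 0
  then show ?case using x by (auto simp: poly_mat_vec_0[OF pencil_carrier])
next
  case (pCons a p)
  then show ?case using x pencil_carrier
    by (simp add: poly_mat_vec_pCons[OF pencil_carrier] mat_vec_scale[OF pencil_carrier] eig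
        smult_smult_assoc mult_ac flip: add_smult_distrib_vec)
qed

text \<open>Only orthogonality to \<open>x\<close> matters, so the derivative stays an unspecified
  \<open>d\<close>. Orthogonality survives each Horner step: the Hermitian pencil can be moved onto
  its eigenvector \<open>x\<close>, and the new term is a multiple of \<open>C *\<^sub>v x\<close>,
  orthogonal to \<open>x\<close> by isotropy.\<close>

lemma poly_mat_vec_pencil_derivative:
  "\<exists>d \<in> carrier_vec n. d \<bullet>c x = 0 \<and>
    (\<forall>i<n. ((\<lambda>t. poly_mat_vec p (pencil t) x $ i) has_vector_derivative d $ i) (at mu))"
proof (induct p)
  case 0
  then show ?case using x
    by (intro bexI[of _ "0\<^sub>v n"]) (auto simp: poly_mat_vec_0[OF pencil_carrier])
next
  case (pCons a p)
  then obtain d where d: "d \<in> carrier_vec n" "d \<bullet>c x = 0"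
    and deriv: "\<And>i. i < n \<Longrightarrow>
      ((\<lambda>t. poly_mat_vec p (pencil t) x $ i) has_vector_derivative d $ i) (at mu)"
    by blast
  let ?y = "\<lambda>t. poly_mat_vec p (pencil t) x"
  let ?l = "poly p (complex_of_real lam)"
  \<comment> \<open>The product rule for the pencil applied to \<open>?y t\<close>: the pencil has
    derivative \<open>- C\<close>, and \<open>?y mu\<close> is
    \<open>?l \<cdot>\<^sub>v x\<close>.\<close>
  let ?d = "pencil mu *\<^sub>v d - ?l \<cdot>\<^sub>v (C *\<^sub>v x)"
  have y: "?y t \<in> carrier_vec n" for t using poly_mat_vec_carrier[OF pencil_carrier x] .
  have carr: "pencil mu *\<^sub>v d \<in> carrier_vec n" "C *\<^sub>v x \<in> carrier_vec n"
    using mult_mat_vec_carrier[OF pencil_carrier d(1)] mult_mat_vec_carrier[OF C(1) x] by auto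
  have "(pencil mu *\<^sub>v d) \<bullet>c x = d \<bullet>c (complex_of_real lam \<cdot>\<^sub>v x)"
    using hermitian_cscalar_prod[OF pencil_hermitian pencil_carrier d(1) x] eig by simp
  also have "\<dots> = 0" using d x by (simp add: conjugate_smult_vec)
  finally have "?d \<bullet>c x = 0"
    using carr x isotropic by (subst minus_scalar_prod_distrib[of _ n]) auto
  moreover have "((\<lambda>t. poly_mat_vec (pCons a p) (pencil t) x $ i) has_vector_derivative ?d $ i) (at mu)"
    if i: "i < n" for i
  proof -
    have "((\<lambda>t. a * x $ i + (\<Sum>j<n. (A $$ (i, j) - complex_of_real t * C $$ (i, j)) * ?y t $ j))
      has_vector_derivative 0 + (\<Sum>j<n. (A $$ (i, j) - complex_of_real mu * C $$ (i, j)) * d $ j +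
         (0 - 1 * C $$ (i, j)) * ?y mu $ j)) (at mu)"
      by (intro has_vector_derivative_add has_vector_derivative_sum has_vector_derivative_mult
          has_vector_derivative_diff has_vector_derivative_const deriv
          has_vector_derivative_mult_left has_vector_derivative_complex_of_real)
         auto
    moreover have "poly_mat_vec (pCons a p) (pencil t) x $ i =
        a * x $ i + (\<Sum>j<n. (A $$ (i, j) - complex_of_real t * C $$ (i, j)) * ?y t $ j)" for t
      using i x y[of t] A C pencil_carrier
      by (simp add: poly_mat_vec_pCons[OF pencil_carrier] scalar_prod_def lessThan_atLeast0)
    moreover have "?d $ i = 0 + (\<Sum>j<n. (A $$ (i, j) - complex_of_real mu * C $$ (i, j)) * d $ j +
         (0 - 1 * C $$ (i, j)) * ?y mu $ j)"
      unfolding poly_mat_vec_pencil_eigenvector using i x d A C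
      by (simp add: scalar_prod_def lessThan_atLeast0 sum_distrib_left sum_subtractf[symmetric] mult_ac)
    ultimately show ?thesis by simp
  qed
  ultimately show ?case using carr by (intro bexI[of _ ?d]) auto
qed

text \<open>The parameter enters through the coefficients of \<open>Q\<close> and through the
  matrix. The matrix contributes nothing to the product with \<open>x\<close>, so only the
  derivative of the coefficients remains, evaluated at the eigenvalue.\<close>

lemma bivariate_pencil_derivative:
  "((\<lambda>t. poly_mat_vec (poly Q [:complex_of_real t:]) (pencil t) x \<bullet>c x) has_vector_derivative
    poly (poly (pderiv Q) [:complex_of_real mu:]) (complex_of_real lam) * (x \<bullet>c x)) (at mu)"
proof (induct Q)
  case 0
  then show ?case using x by (simp add: poly_mat_vec_0[OF pencil_carrier])
next
  case (pCons c Q)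
  let ?y = "\<lambda>t. poly_mat_vec c (pencil t) x"
  let ?f = "\<lambda>t. poly_mat_vec (poly Q [:complex_of_real t:]) (pencil t) x"
  have carr: "poly_mat_vec p (pencil t) x \<in> carrier_vec n" for p t
    using poly_mat_vec_carrier[OF pencil_carrier x] .
  obtain d where d: "d \<in> carrier_vec n" "d \<bullet>c x = 0"
    and deriv: "\<And>i. i < n \<Longrightarrow> ((\<lambda>t. ?y t $ i) has_vector_derivative d $ i) (at mu)"
    using poly_mat_vec_pencil_derivative[of c] by blast
  have "((\<lambda>t. \<Sum>i<n. ?y t $ i * cnj (x $ i)) has_vector_derivative (\<Sum>i<n. d $ i * cnj (x $ i))) (at mu)"
    by (intro has_vector_derivative_sum has_vector_derivative_mult_left deriv) simp
  then have y: "((\<lambda>t. ?y t \<bullet>c x) has_vector_derivative 0) (at mu)"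
    using d x carr by (simp add: scalar_prod_def lessThan_atLeast0)
  have "((\<lambda>t. ?y t \<bullet>c x + complex_of_real t * (?f t \<bullet>c x)) has_vector_derivative
    0 + (complex_of_real mu * (poly (poly (pderiv Q) [:complex_of_real mu:]) (complex_of_real lam) * (x \<bullet>c x))
      + 1 * (?f mu \<bullet>c x))) (at mu)"
    by (intro has_vector_derivative_add has_vector_derivative_mult y pCons
          has_vector_derivative_complex_of_real)
  moreover have "poly_mat_vec (poly (pCons c Q) [:complex_of_real t:]) (pencil t) x \<bullet>c x =
      ?y t \<bullet>c x + complex_of_real t * (?f t \<bullet>c x)" for t
    using carr x by (simp add: poly_mat_vec_add[OF pencil_carrier] poly_mat_vec_smult[OF pencil_carrier]
        add_scalar_prod_distrib[of _ n])
  ultimately show ?case using x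
    by (simp add: pderiv_pCons poly_mat_vec_pencil_eigenvector algebra_simps)
qed

text \<open>The differentiated function is identically 0, since a polynomial vanishing on the
  spectrum of a Hermitian matrix annihilates every vector.\<close>

lemma pderiv_eq_0_at_2D_eigenvalue:
  assumes Q: "\<And>t a. eigenvalue (pencil t) a \<Longrightarrow> poly (poly Q [:complex_of_real t:]) a = 0"
    and "x \<bullet>c x = 1"
  shows "poly (poly (pderiv Q) [:complex_of_real mu:]) (complex_of_real lam) = 0"
proof -
  have "poly_mat_vec (poly Q [:complex_of_real t:]) (pencil t) x \<bullet>c x = 0" for t
    using hermitian_poly_mat_vec_eq_0[OF pencil_hermitian pencil_carrier x Q] x by simp
  then have "((\<lambda>t::real. 0) has_vector_derivative
      poly (poly (pderiv Q) [:complex_of_real mu:]) (complex_of_real lam)) (at mu)"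
    using bivariate_pencil_derivative[of Q] assms(2) by simp
  then have "(\<lambda>h. h *\<^sub>R poly (poly (pderiv Q) [:complex_of_real mu:]) (complex_of_real lam)) =
      (\<lambda>h. h *\<^sub>R 0)"
    unfolding has_vector_derivative_def
    by (rule has_derivative_unique) (use has_vector_derivative_const in \<open>simp add: has_vector_derivative_def\<close>)
  from fun_cong[OF this, of 1] show ?thesis by simp
qed

end

section \<open>Finiteness for regular pencils\<close>

lemma finite_eigenvalues_2D_if_regular:
  assumes A: "A \<in> carrier_mat n n" "hermitian_mat A"
    and C: "C \<in> carrier_mat n n" "hermitian_mat C"
    and regular: "\<And>\<sigma>::real. regular_pair (A - complex_of_real \<sigma> \<cdot>\<^sub>m 1\<^sub>m n) C"
  shows "finite (eigenvalues_2D A C)"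
proof -
  let ?P = "pencil_poly A C"
  let ?ev = "\<lambda>p (m::real) l. poly (poly p [:complex_of_real m:]) l"
  \<comment> \<open>Regularity for the shift \<open>l\<close> provides a parameter at which the
    slice of \<open>?P\<close> at \<lambda> = \<open>l\<close> is nonzero.\<close>
  have slice: "map_poly (\<lambda>c. poly c (complex_of_real l)) ?P \<noteq> 0" for l :: real
    using regular[of l] poly_map_poly_poly[of "complex_of_real l" ?P] poly_pencil_poly[OF A(1) C(1)]
    unfolding regular_pair_def by (metis poly_0)
  then have "?P \<noteq> 0" by auto
  then obtain Q k a b r where Q: "Q dvd ?P" "?P dvd Q ^ k" "a * Q + b * pderiv Q = [:r:]" "r \<noteq> 0"
    by (rule squarefree_kernel_exists)
  have Q_eig: "?ev Q t c = 0" if "eigenvalue (A - complex_of_real t \<cdot>\<^sub>m C) c" for t c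
  proof -
    have "?ev ?P t c = 0"
      using that poly_pencil_poly[OF A(1) C(1)] det_pencil_eq_0_iff[OF A(1) C(1)] by simp
    moreover obtain R where "Q ^ k = ?P * R" using Q(2) by blast
    ultimately have "?ev (Q ^ k) t c = 0" by simp
    then show ?thesis unfolding poly_power by (metis power_not_zero)
  qed
  \<comment> \<open>The roots of \<open>r\<close> bound \<lambda>, and the slice over each root
    bounds \<mu>. The swap is needed because the fibres lie over \<lambda>, the second
    component.\<close>
  have "eigenvalues_2D A C \<subseteq> prod.swap ` (SIGMA l:{l. poly r (complex_of_real l) = 0}.
      {m. poly (map_poly (\<lambda>c. poly c (complex_of_real l)) ?P) (complex_of_real m) = 0})"
  proof clarify
    fix m l assume "(m, l) \<in> eigenvalues_2D A C"
    then obtain x where x: "x \<in> carrier_vec n"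
      "(A - complex_of_real m \<cdot>\<^sub>m C) *\<^sub>v x = complex_of_real l \<cdot>\<^sub>v x"
      "(C *\<^sub>v x) \<bullet>c x = 0" "x \<bullet>c x = 1"
      unfolding eigenvalues_2D_def using A by auto
    have "x \<noteq> 0\<^sub>v n" using x(1,4) by auto
    then have eig: "eigenvalue (A - complex_of_real m \<cdot>\<^sub>m C) (complex_of_real l)"
      unfolding eigenvalue_def eigenvector_def using x C by auto
    have "?ev (a * Q + b * pderiv Q) m (complex_of_real l) = 0"
      using Q_eig[OF eig] pderiv_eq_0_at_2D_eigenvalue[OF A C x(1-3) Q_eig x(4)] by simp
    then have "poly r (complex_of_real l) = 0" unfolding Q(3) by simp
    moreover have "?ev ?P m (complex_of_real l) = 0"
      using eig poly_pencil_poly[OF A(1) C(1)] det_pencil_eq_0_iff[OF A(1) C(1)] by simp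
    ultimately show "(m, l) \<in> prod.swap ` (SIGMA l:{l. poly r (complex_of_real l) = 0}.
      {m. poly (map_poly (\<lambda>c. poly c (complex_of_real l)) ?P) (complex_of_real m) = 0})"
      unfolding poly_map_poly_poly by force
  qed
  moreover have "finite {t::real. poly p (complex_of_real t) = 0}" if "p \<noteq> 0" for p
    using finite_vimageI[OF poly_roots_finite[OF that], of complex_of_real]
    by (simp add: vimage_def inj_on_def)
  then have "finite (prod.swap ` (SIGMA l:{l. poly r (complex_of_real l) = 0}.
      {m. poly (map_poly (\<lambda>c. poly c (complex_of_real l)) ?P) (complex_of_real m) = 0}))"
    using slice Q(4) by (intro finite_imageI finite_SigmaI) auto
  ultimately show ?thesis by (rule finite_subset)
qed

section \<open>Singular pencils\<close>

text \<open>The determinant vanishes as a polynomial, so over the integral domain of polynomials the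
  pencil has a nonzero kernel vector. Evaluation at \<theta> is a ring homomorphism and preserves
  the kernel equation.\<close>

lemma singular_kernel_poly_vec:
  fixes H C :: "complex mat"
  assumes H: "H \<in> carrier_mat n n" and C: "C \<in> carrier_mat n n" and "\<not> regular_pair H C"
  obtains v where "v \<in> carrier_vec n" "v \<noteq> 0\<^sub>v n"
    "\<And>\<theta>. H *\<^sub>v map_vec (\<lambda>p. poly p \<theta>) v = \<theta> \<cdot>\<^sub>v (C *\<^sub>v map_vec (\<lambda>p. poly p \<theta>) v)"
proof -
  define K where "K = mat n n (\<lambda>(i, j). [:H $$ (i, j), - C $$ (i, j):])"
  have K: "K \<in> carrier_mat n n" unfolding K_def by simp
  have ev: "map_mat (\<lambda>p. poly p \<theta>) K = H - \<theta> \<cdot>\<^sub>m C" for \<theta>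
    unfolding K_def using H C by (intro eq_matI) auto
  have hom: "comm_ring_hom (\<lambda>p. poly p \<theta>)" for \<theta> :: complex
    by standard simp_all
  have semiring_hom: "semiring_hom (\<lambda>p. poly p \<theta>)" for \<theta> :: complex
    by standard simp_all
  have "poly (det K) \<theta> = 0" for \<theta>
    using assms(3) comm_ring_hom.hom_det[OF hom, of \<theta> K] unfolding ev regular_pair_def by metis
  then have "det K = 0" using poly_all_0_iff_0 by blast
  then obtain v where v: "v \<in> carrier_vec n" "v \<noteq> 0\<^sub>v n" "K *\<^sub>v v = 0\<^sub>v n"
    using det_0_iff_vec_prod_zero[OF K] by blast
  have "H *\<^sub>v map_vec (\<lambda>p. poly p \<theta>) v = \<theta> \<cdot>\<^sub>v (C *\<^sub>v map_vec (\<lambda>p. poly p \<theta>) v)" for \<theta>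
  proof -
    have "(H - \<theta> \<cdot>\<^sub>m C) *\<^sub>v map_vec (\<lambda>p. poly p \<theta>) v = map_vec (\<lambda>p. poly p \<theta>) (0\<^sub>v n)"
      using semiring_hom.mult_mat_vec_hom[OF semiring_hom K v(1), of \<theta>] unfolding ev v(3) by simp
    also have "\<dots> = 0\<^sub>v n" by auto
    finally have "(H - \<theta> \<cdot>\<^sub>m C) *\<^sub>v map_vec (\<lambda>p. poly p \<theta>) v = 0\<^sub>v n" .
    then show ?thesis using H C v
      by (subst vec_eq_iff_diff_eq_0[of _ n]) (simp_all add: mat_diff_smult_mult_vec[of _ n n])
  qed
  with v that show ?thesis by blast
qed

text \<open>For distinct real parameters, kernel vectors of the pencil are orthogonal with respect to
  $C$. Since they depend polynomially on the parameter, the two parameters may coincide.\<close>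
lemma kernel_poly_vec_isotropic:
  fixes H C :: "complex mat" and mu :: real
  assumes H: "H \<in> carrier_mat n n" "hermitian_mat H"
    and C: "C \<in> carrier_mat n n" "hermitian_mat C"
    and v: "v \<in> carrier_vec n"
      "\<And>\<theta>. H *\<^sub>v map_vec (\<lambda>p. poly p \<theta>) v = \<theta> \<cdot>\<^sub>v (C *\<^sub>v map_vec (\<lambda>p. poly p \<theta>) v)"
  shows "(C *\<^sub>v map_vec (\<lambda>p. poly p (complex_of_real mu)) v) \<bullet>c
    map_vec (\<lambda>p. poly p (complex_of_real mu)) v = 0"
proof -
  define X where "X = (\<lambda>\<theta>. map_vec (\<lambda>p. poly p \<theta>) v)"
  let ?m = "complex_of_real mu"
  have X: "X \<theta> \<in> carrier_vec n" and CX: "C *\<^sub>v X \<theta> \<in> carrier_vec n" for \<theta>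
    using v(1) C(1) unfolding X_def by auto
  have HX: "H *\<^sub>v X \<theta> = \<theta> \<cdot>\<^sub>v (C *\<^sub>v X \<theta>)" for \<theta>
    using v(2) unfolding X_def .
  \<comment> \<open>The second argument is frozen at \<open>mu\<close>, so conjugation only meets
    constants and the form is a polynomial in \<theta>.\<close>
  define W where "W = (\<Sum>i<n. (\<Sum>j<n. [:C $$ (i, j):] * v $ j) * [:cnj (X ?m $ i):])"
  have W: "poly W \<theta> = (C *\<^sub>v X \<theta>) \<bullet>c X ?m" for \<theta>
    using v(1) C(1) unfolding W_def X_def
    by (simp add: poly_sum scalar_prod_def lessThan_atLeast0 mult.commute)
  have "poly W (complex_of_real t) = 0" if "t \<noteq> mu" for t
  proof -
    let ?t = "complex_of_real t"
    \<comment> \<open>Evaluating the form of \<open>H\<close> from either side gives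
      \<open>?t\<close> and \<open>?m\<close> times the same number, which is therefore 0.\<close>
    have "?t * ((C *\<^sub>v X ?t) \<bullet>c X ?m) = (H *\<^sub>v X ?t) \<bullet>c X ?m"
      unfolding HX by (rule smult_scalar_prod_distrib[OF CX carrier_vec_conjugate[OF X], symmetric])
    also have "\<dots> = X ?t \<bullet>c (H *\<^sub>v X ?m)"
      by (rule hermitian_cscalar_prod[OF H(2,1) X X])
    also have "\<dots> = ?m * (X ?t \<bullet>c (C *\<^sub>v X ?m))"
      unfolding HX conjugate_smult_vec
      by (simp add: scalar_prod_smult_distrib[OF X carrier_vec_conjugate[OF CX]])
    also have "X ?t \<bullet>c (C *\<^sub>v X ?m) = (C *\<^sub>v X ?t) \<bullet>c X ?m"
      by (rule hermitian_cscalar_prod[OF C(2,1) X X, symmetric])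
    finally show ?thesis using that by (simp add: W)
  qed
  then have "complex_of_real ` (- {mu}) \<subseteq> {z. poly W z = 0}" by auto
  moreover have "infinite (complex_of_real ` (- {mu}))"
    by (subst finite_image_iff) (simp_all add: inj_on_def infinite_UNIV_char_0)
  ultimately have "W = 0" using poly_roots_finite finite_subset by blast
  then show ?thesis using W[of ?m] unfolding X_def by simp
qed

lemma normalized_vec_exists:
  fixes y :: "complex vec"
  assumes "y \<in> carrier_vec n" "y \<noteq> 0\<^sub>v n"
  obtains c where "(c \<cdot>\<^sub>v y) \<bullet>c (c \<cdot>\<^sub>v y) = 1"
proof -
  define s where "s = Re (y \<bullet>c y)"
  have "y \<bullet>c y > 0" using assms by simp
  then have s: "y \<bullet>c y = complex_of_real s" "s > 0"
    unfolding s_def by (auto simp: less_complex_def complex_eq_iff)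
  then obtain c where c: "c * (c * s) = 1"
    by (intro that[of "1 / sqrt s"]) (simp add: field_simps)
  have "(complex_of_real c \<cdot>\<^sub>v y) \<bullet>c (complex_of_real c \<cdot>\<^sub>v y) = complex_of_real (c * (c * s))"
    using assms(1) by (simp add: conjugate_smult_vec s(1))
  then show ?thesis using that c by simp
qed

text \<open>The polynomial kernel vector yields isotropic eigenvectors for the fixed eigenvalue
  \<sigma> at all but finitely many real parameters.\<close>

lemma infinite_eigenvalues_2D_if_singular:
  fixes \<sigma> :: real
  assumes A: "A \<in> carrier_mat n n" "hermitian_mat A"
    and C: "C \<in> carrier_mat n n" "hermitian_mat C"
    and singular: "\<not> regular_pair (A - complex_of_real \<sigma> \<cdot>\<^sub>m 1\<^sub>m n) C"
  shows "infinite (eigenvalues_2D A C)"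
proof -
  let ?H = "A - complex_of_real \<sigma> \<cdot>\<^sub>m 1\<^sub>m n"
  have H: "?H \<in> carrier_mat n n" "hermitian_mat ?H"
    using hermitian_mat_diff_smult[OF A(2,1) hermitian_mat_one one_carrier_mat]
    by (simp_all add: minus_carrier_mat)
  obtain v where v: "v \<in> carrier_vec n" "v \<noteq> 0\<^sub>v n"
    "\<And>\<theta>. ?H *\<^sub>v map_vec (\<lambda>p. poly p \<theta>) v = \<theta> \<cdot>\<^sub>v (C *\<^sub>v map_vec (\<lambda>p. poly p \<theta>) v)"
    using singular_kernel_poly_vec[OF H(1) C(1) singular] by blast
  \<comment> \<open>A single nonzero entry suffices: away from its finitely many roots the evaluated
    vector is nonzero.\<close>
  obtain i where i: "i < n" "v $ i \<noteq> 0"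
    using v(1,2) by (metis carrier_vecD eq_vecI index_zero_vec)
  let ?S = "{m::real. poly (v $ i) (complex_of_real m) = 0}"
  have "(m, \<sigma>) \<in> eigenvalues_2D A C" if "m \<notin> ?S" for m
  proof -
    let ?m = "complex_of_real m"
    let ?y = "map_vec (\<lambda>p. poly p ?m) v"
    have y: "?y \<in> carrier_vec n" using v(1) by simp
    have "?y $ i \<noteq> 0" using that i v(1) by simp
    then have "?y \<noteq> 0\<^sub>v n" using i(1) by (metis index_zero_vec(1))
    then obtain c where c: "(c \<cdot>\<^sub>v ?y) \<bullet>c (c \<cdot>\<^sub>v ?y) = 1" using normalized_vec_exists[OF y] by blast
    have Ay: "A *\<^sub>v ?y \<in> carrier_vec n" and Cy: "C *\<^sub>v ?y \<in> carrier_vec n" using A C y by auto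
    have "A *\<^sub>v ?y - complex_of_real \<sigma> \<cdot>\<^sub>v ?y = ?m \<cdot>\<^sub>v (C *\<^sub>v ?y)"
      using v(3)[of ?m] A y by (simp add: mat_diff_smult_mult_vec[of _ n n])
    then have "A *\<^sub>v ?y - ?m \<cdot>\<^sub>v (C *\<^sub>v ?y) = complex_of_real \<sigma> \<cdot>\<^sub>v ?y"
      by (rule vec_diff_swap[OF _ Ay]) (rule smult_carrier_vec[THEN iffD2, OF y])
    then have "(A - ?m \<cdot>\<^sub>m C) *\<^sub>v ?y = complex_of_real \<sigma> \<cdot>\<^sub>v ?y"
      using A C y by (simp add: mat_diff_smult_mult_vec[of _ n n])
    then have "(A - ?m \<cdot>\<^sub>m C) *\<^sub>v (c \<cdot>\<^sub>v ?y) = complex_of_real \<sigma> \<cdot>\<^sub>v (c \<cdot>\<^sub>v ?y)"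
      using mat_vec_scale[of "A - ?m \<cdot>\<^sub>m C" n ?y c] C y
      by (simp add: minus_carrier_mat smult_smult_assoc mult.commute)
    moreover have "(C *\<^sub>v (c \<cdot>\<^sub>v ?y)) \<bullet>c (c \<cdot>\<^sub>v ?y) = 0"
      using kernel_poly_vec_isotropic[OF H C v(1,3), of m] C y Cy
      by (simp add: mat_vec_scale[of C n] conjugate_smult_vec)
    ultimately show ?thesis unfolding eigenvalues_2D_def using A y c by auto
  qed
  then have "(\<lambda>m. (m, \<sigma>)) ` (- ?S) \<subseteq> eigenvalues_2D A C" by auto
  moreover have "finite ?S"
    using finite_vimageI[OF poly_roots_finite[OF i(2)], of complex_of_real]
    by (simp add: vimage_def inj_on_def)
  then have "infinite (- ?S)" by (metis finite_compl infinite_UNIV_char_0)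
  then have "infinite ((\<lambda>m. (m, \<sigma>)) ` (- ?S))"
    by (subst finite_image_iff) (simp_all add: inj_on_def)
  ultimately show ?thesis using finite_subset by blast
qed

theorem theorem6p1:
  fixes A C :: "complex mat" and n :: nat
  assumes "A \<in> carrier_mat n n" and "C \<in> carrier_mat n n"
    and "hermitian_mat A" and "hermitian_mat C"
    and "indefinite_mat C"
  shows "finite (eigenvalues_2D A C) \<longleftrightarrow>
    (\<forall>\<sigma>::real. regular_pair (A - complex_of_real \<sigma> \<cdot>\<^sub>m 1\<^sub>m n) C)"
  using finite_eigenvalues_2D_if_regular infinite_eigenvalues_2D_if_singular assms by blast

end
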